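(* For all persistence diagrams $D$ and $D'$, $$\Lambda_\infty(D,D')\le W_\infty(D,D').$$
   Context: A persistence diagram is an equivalence class of multisets of pairs of real numbers $(b,d)$ with $b\le d$, where $D\sim D\amalg\{(t,t)\}$ for any $t\in\mathbb{R}$, so points on the diagonal may be freely adjoined (as many as necessary). Each diagram has a unique representative $\hat D$ with no points on the diagonal. The persistence landscape of $D$ is $\lambda:\mathbb{N}\times\mathbb{R}\to[0,\infty]$, $\mathbb{N}=\{1,2,\ldots\}$, where $\lambda_k(t)=\lambda(k,t)$ is the supremum of all $m\ge0$ such that at least $k$ points $(b,d)$ of $\hat D$ (with multiplicity) satisfy $b\le t-m$ and $t+m\le d$, with $\sup\emptyset=0$; for finite $D$, $\lambda_k(t)$ is the $k$th largest value of $\max(\min(t-b,d-t),0)$ over $(b,d)\in\hat D$ (and $0$ if there are fewer than $k$ points). If $\lambda,\lambda'$ are the landscapes of $D,D'$, then $\Lambda_\infty(D,D')=\|\lambda-\lambda'\|_\infty$, the $L^\infty$ norm on $\mathbb{N}\times\mathbb{R}$ (counting measure times Lebesgue measure), with the convention $\infty-\infty=0$. The bottleneck distance is $W_\infty(D,D')=\inf_{\varphi}\sup_j\varepsilon_j$, where the infimum is over all bijections $\varphi:x_j\mapsto x_j'$ between representatives of $D$ and $D'$ (with diagonal points adjoined as needed), $x_j=(b_j,d_j)$, $x_j'=(b_j',d_j')$, and $\varepsilon_j=\|x_j-x_j'\|_\infty=\max(|b_j-b_j'|,|d_j-d_j'|)$. *)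

theory Defs
  imports
    "HOL-Analysis.Analysis"
    "HOL-Probability.Essential_Supremum"
    "HOL-Library.Infinite_Typeclass"
begin

section \<open>Multisets of points as indexed families\<close>

text \<open>
  The multisets underlying persistence diagrams may be infinite, and any number of diagonal points
  may have to be adjoined, so the type of finite multisets does not apply. A multiset is given as a
  family \<open>x :: 'a \<rightharpoonup> real \<times> real\<close> indexed by \<^term>\<open>dom x\<close>: each point occurs as often as it
  has indices, and two families are the same multiset iff they agree up to a bijection of indices.

  The type \<open>'a\<close> of indices is an arbitrary infinite type. It only bounds the cardinality: any two
  multisets have families over a common such type, and that type then has room for all
  diagonal points which a matching of the two can use (at most one for each point
  off the diagonal), pairs of a diagonal point with a diagonal point being superfluous.
\<close>

type_synonym point = "real \<times> real"

definition points_ok :: "('a \<rightharpoonup> point) \<Rightarrow> bool" where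
  "points_ok x \<longleftrightarrow> (\<forall>(b, d) \<in> ran x. b \<le> d)"

definition diagonal :: "('a \<rightharpoonup> point) \<Rightarrow> bool" where
  "diagonal x \<longleftrightarrow> (\<forall>(b, d) \<in> ran x. b = d)"

definition same_multiset :: "('a \<rightharpoonup> 'c) \<Rightarrow> ('b \<rightharpoonup> 'c) \<Rightarrow> bool" where
  "same_multiset x y \<longleftrightarrow> (\<exists>f. bij_betw f (dom x) (dom y) \<and> (\<forall>i \<in> dom x. y (f i) = x i))"

abbreviation disjoint_union :: "('a \<rightharpoonup> 'c) \<Rightarrow> ('b \<rightharpoonup> 'c) \<Rightarrow> ('a + 'b \<rightharpoonup> 'c)" where
  "disjoint_union \<equiv> case_sum"

definition diagram_equiv :: "('a \<rightharpoonup> point) \<Rightarrow> ('a \<rightharpoonup> point) \<Rightarrow> bool" where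
  "diagram_equiv x y \<longleftrightarrow> points_ok x \<and> points_ok y \<and>
     (\<exists>(p :: 'a \<rightharpoonup> point) (q :: 'a \<rightharpoonup> point). diagonal p \<and> diagonal q \<and>
        same_multiset (disjoint_union x p) (disjoint_union y q))"

definition off_diagonal :: "('a \<rightharpoonup> point) \<Rightarrow> ('a \<rightharpoonup> point)" where
  "off_diagonal x = x |` {i. \<exists>b d. x i = Some (b, d) \<and> b \<noteq> d}"

lemma dom_disjoint_union: "dom (disjoint_union x y) = Inl ` dom x \<union> Inr ` dom y"
proof (rule set_eqI)
  fix s show "s \<in> dom (disjoint_union x y) \<longleftrightarrow> s \<in> Inl ` dom x \<union> Inr ` dom y"
    by (cases s) (auto simp: dom_def)
qed

lemma dom_off_diagonal: "dom (off_diagonal x) = {i. \<exists>b d. x i = Some (b, d) \<and> b \<noteq> d}"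
  by (auto simp: off_diagonal_def restrict_map_def dom_def)

lemma off_diagonal_eq: "i \<in> dom (off_diagonal x) \<Longrightarrow> off_diagonal x i = x i"
  by (auto simp: off_diagonal_def restrict_map_def dom_def split: if_splits)

lemma dom_off_diagonal_subset: "dom (off_diagonal x) \<subseteq> dom x"
  by (auto simp: dom_off_diagonal)

lemma same_multiset_refl: "same_multiset x x"
  unfolding same_multiset_def by (rule exI[of _ id]) auto

lemma same_multiset_sym:
  assumes "same_multiset x y" shows "same_multiset y x"
proof -
  obtain f where f: "bij_betw f (dom x) (dom y)" "\<forall>i \<in> dom x. y (f i) = x i"
    using assms unfolding same_multiset_def by blast
  have "\<forall>j \<in> dom y. x (inv_into (dom x) f j) = y j"
    using f by (metis bij_betw_imp_surj_on f_inv_into_f inv_into_into)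
  then show ?thesis
    using bij_betw_inv_into[OF f(1)] unfolding same_multiset_def by blast
qed

lemma same_multiset_trans:
  assumes "same_multiset x y" "same_multiset y z" shows "same_multiset x z"
proof -
  obtain f g where f: "bij_betw f (dom x) (dom y)" "\<forall>i \<in> dom x. y (f i) = x i"
    and g: "bij_betw g (dom y) (dom z)" "\<forall>i \<in> dom y. z (g i) = y i"
    using assms unfolding same_multiset_def by blast
  have "\<forall>i \<in> dom x. z ((g \<circ> f) i) = x i"
    using f g by (metis bij_betwE comp_apply)
  then show ?thesis
    using bij_betw_trans[OF f(1) g(1)] unfolding same_multiset_def by blast
qed

lemma same_multiset_off_diagonal:
  assumes "same_multiset x y"
  shows "same_multiset (off_diagonal x) (off_diagonal y)"
proof -
  obtain f where f: "bij_betw f (dom x) (dom y)" "\<forall>i \<in> dom x. y (f i) = x i"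
    using assms unfolding same_multiset_def by blast
  have iff: "f i \<in> dom (off_diagonal y) \<longleftrightarrow> i \<in> dom (off_diagonal x)" if "i \<in> dom x" for i
    using bspec[OF f(2) that] by (simp add: dom_off_diagonal)
  have "f ` dom (off_diagonal x) = dom (off_diagonal y)"
  proof
    show "f ` dom (off_diagonal x) \<subseteq> dom (off_diagonal y)"
      using iff dom_off_diagonal_subset[of x] by blast
    show "dom (off_diagonal y) \<subseteq> f ` dom (off_diagonal x)"
    proof
      fix j assume j: "j \<in> dom (off_diagonal y)"
      then obtain i where "i \<in> dom x" "j = f i"
        using f(1) dom_off_diagonal_subset[of y] unfolding bij_betw_def by blast
      then show "j \<in> f ` dom (off_diagonal x)"
        using j iff by blast
    qed
  qed
  then have "bij_betw f (dom (off_diagonal x)) (dom (off_diagonal y))"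
    using inj_on_subset[OF bij_betw_imp_inj_on[OF f(1)] dom_off_diagonal_subset[of x]]
    by (simp only: bij_betw_def)
  moreover have "off_diagonal y (f i) = off_diagonal x i" if "i \<in> dom (off_diagonal x)" for i
  proof -
    have i: "i \<in> dom x" using that dom_off_diagonal_subset[of x] by blast
    then show ?thesis
      using f(2) off_diagonal_eq[OF that] off_diagonal_eq[of "f i" y] iff[OF i] that by simp
  qed
  ultimately show ?thesis
    unfolding same_multiset_def by blast
qed

lemma off_diagonal_disjoint_union_diagonal:
  assumes "diagonal p"
  shows "same_multiset (off_diagonal x) (off_diagonal (disjoint_union x p))"
proof -
  have p: "b = d" if "p j = Some (b, d)" for j b d
    using assms that by (auto simp: diagonal_def ran_def)
  have dom: "dom (off_diagonal (disjoint_union x p)) = Inl ` dom (off_diagonal x)"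
  proof (rule set_eqI)
    fix s show "s \<in> dom (off_diagonal (disjoint_union x p)) \<longleftrightarrow> s \<in> Inl ` dom (off_diagonal x)"
      by (cases s) (auto simp: dom_off_diagonal dest: p)
  qed
  then have "bij_betw Inl (dom (off_diagonal x)) (dom (off_diagonal (disjoint_union x p)))"
    by (simp add: bij_betw_def)
  moreover have "off_diagonal (disjoint_union x p) (Inl i) = off_diagonal x i"
    if "i \<in> dom (off_diagonal x)" for i
    using that dom by (simp add: off_diagonal_eq)
  ultimately show ?thesis
    unfolding same_multiset_def by blast
qed

lemma same_multiset_swap_diagonal:
  fixes x :: "'a \<rightharpoonup> point" and y :: "'b \<rightharpoonup> point"
  assumes "same_multiset (off_diagonal x) (off_diagonal y)"
  shows "same_multiset (disjoint_union x (y |` (- dom (off_diagonal y))))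
           (disjoint_union y (x |` (- dom (off_diagonal x))))"
proof -
  let ?X = "dom (off_diagonal x)" and ?Y = "dom (off_diagonal y)"
  obtain f where f: "bij_betw f ?X ?Y" "\<forall>i \<in> ?X. off_diagonal y (f i) = off_diagonal x i"
    using assms unfolding same_multiset_def by blast
  have sub: "?X \<subseteq> dom x" "?Y \<subseteq> dom y"
    by (rule dom_off_diagonal_subset)+
  have fY: "f i \<in> ?Y" if "i \<in> ?X" for i
    using that bij_betwE[OF f(1)] by blast
  have fy: "y (f i) = x i" if "i \<in> ?X" for i
    using f(2) that fY[OF that] by (metis off_diagonal_eq)
  define g where "g = case_sum (\<lambda>i. if i \<in> ?X then Inl (f i) else Inr i) (Inl :: 'b \<Rightarrow> 'b + 'a)"
  have "dom (disjoint_union x (y |` (- ?Y))) = Inl ` dom x \<union> Inr ` (dom y - ?Y)"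
    by (simp add: dom_disjoint_union Diff_eq)
  moreover have "dom (disjoint_union y (x |` (- ?X))) = Inl ` dom y \<union> Inr ` (dom x - ?X)"
    by (simp add: dom_disjoint_union Diff_eq)
  moreover have "bij_betw g (Inl ` dom x \<union> Inr ` (dom y - ?Y)) (Inl ` dom y \<union> Inr ` (dom x - ?X))"
    unfolding bij_betw_def
  proof
    show "inj_on g (Inl ` dom x \<union> Inr ` (dom y - ?Y))"
    proof (rule inj_onI)
      fix s t assume st: "g s = g t"
        "s \<in> Inl ` dom x \<union> Inr ` (dom y - ?Y)" "t \<in> Inl ` dom x \<union> Inr ` (dom y - ?Y)"
      have *: "f i \<in> ?Y \<and> (i' \<in> ?X \<longrightarrow> f i = f i' \<longrightarrow> i = i')" if "i \<in> ?X" for i i'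
        using f(1) that fY unfolding bij_betw_def inj_on_def by blast
      show "s = t"
      proof (cases s)
        case (Inl i)
        then show ?thesis
          using st * by (cases t) (auto simp: g_def simp del: domIff split: if_splits)
      next
        case (Inr i)
        then show ?thesis
          using st * by (cases t) (auto simp: g_def simp del: domIff split: if_splits)
      qed
    qed
    have "Inl j \<in> g ` (Inl ` dom x \<union> Inr ` (dom y - ?Y))" if "j \<in> dom y" for j
    proof (cases "j \<in> ?Y")
      case True
      then obtain i where "i \<in> ?X" "j = f i"
        using f(1) unfolding bij_betw_def by blast
      then have "g (Inl i) = Inl j" "i \<in> dom x" using sub by (auto simp: g_def)
      then show ?thesis by (metis UnI1 imageI)
    next
      case False
      then have "g (Inr j) = Inl j" "j \<in> dom y - ?Y" using that by (auto simp: g_def)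
      then show ?thesis by (metis UnI2 imageI)
    qed
    moreover have "Inr i \<in> g ` (Inl ` dom x \<union> Inr ` (dom y - ?Y))" if "i \<in> dom x - ?X" for i
    proof -
      have "g (Inl i) = Inr i" "i \<in> dom x" using that by (auto simp: g_def)
      then show ?thesis by (metis UnI1 imageI)
    qed
    moreover have "g s \<in> Inl ` dom y \<union> Inr ` (dom x - ?X)"
      if "s \<in> Inl ` dom x \<union> Inr ` (dom y - ?Y)" for s
      using that
    proof (elim UnE imageE)
      fix i assume "s = Inl i" "i \<in> dom x"
      then show ?thesis
        using subsetD[OF sub(2) fY[of i]]
        by (cases "i \<in> ?X") (simp_all add: g_def image_iff del: domIff)
    next
      fix j assume "s = Inr j" "j \<in> dom y - ?Y"
      then show ?thesis
        by (auto simp: g_def simp del: domIff)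
    qed
    ultimately show "g ` (Inl ` dom x \<union> Inr ` (dom y - ?Y)) = Inl ` dom y \<union> Inr ` (dom x - ?X)"
      by blast
  qed
  moreover have "disjoint_union y (x |` (- ?X)) (g i) = disjoint_union x (y |` (- ?Y)) i"
    if "i \<in> Inl ` dom x \<union> Inr ` (dom y - ?Y)" for i
    using that
  proof (elim UnE imageE)
    fix j assume "i = Inl j" "j \<in> dom x"
    then show ?thesis
      using fy[of j] by (cases "j \<in> ?X") (simp_all add: g_def del: domIff)
  next
    fix j assume "i = Inr j" "j \<in> dom y - ?Y"
    then show ?thesis
      by (simp add: g_def restrict_map_def del: domIff)
  qed
  ultimately show ?thesis
    unfolding same_multiset_def by (intro exI[of _ g]) (simp del: domIff)
qed

lemma diagonal_restrict: "diagonal (x |` (- dom (off_diagonal x)))"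
  by (auto simp: diagonal_def ran_def dom_off_diagonal restrict_map_def split: if_splits)

lemma diagram_equiv_iff_off_diagonal:
  "diagram_equiv x y \<longleftrightarrow>
     points_ok x \<and> points_ok y \<and> same_multiset (off_diagonal x) (off_diagonal y)"
proof -
  have "same_multiset (off_diagonal x) (off_diagonal y)"
    if "diagonal p" "diagonal q" "same_multiset (disjoint_union x p) (disjoint_union y q)"
    for p q :: "'a \<rightharpoonup> point"
    using off_diagonal_disjoint_union_diagonal[OF that(1)]
      off_diagonal_disjoint_union_diagonal[OF that(2)] same_multiset_off_diagonal[OF that(3)]
    by (meson same_multiset_sym same_multiset_trans)
  then show ?thesis
    unfolding diagram_equiv_def
    using same_multiset_swap_diagonal diagonal_restrict by blast
qed

section \<open>Persistence diagrams\<close>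

quotient_type 'a persistence_diagram =
  "'a :: infinite \<rightharpoonup> point" / partial: diagram_equiv
proof (rule part_equivpI)
  show "\<exists>x :: 'a \<rightharpoonup> point. diagram_equiv x x"
    by (rule exI[of _ Map.empty])
      (auto simp: diagram_equiv_iff_off_diagonal points_ok_def intro: same_multiset_refl)
  show "symp (diagram_equiv :: ('a \<rightharpoonup> point) \<Rightarrow> _)"
    by (auto simp: symp_def diagram_equiv_iff_off_diagonal intro: same_multiset_sym)
  show "transp (diagram_equiv :: ('a \<rightharpoonup> point) \<Rightarrow> _)"
    by (auto simp: transp_def diagram_equiv_iff_off_diagonal intro: same_multiset_trans)
qed

definition represents :: "('a :: infinite \<rightharpoonup> point) \<Rightarrow> 'a persistence_diagram \<Rightarrow> bool" where
  "represents x D \<longleftrightarrow> points_ok x \<and> abs_persistence_diagram x = D"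

section \<open>Persistence landscapes\<close>

definition at_least :: "nat \<Rightarrow> 'a set \<Rightarrow> bool" where
  "at_least k S \<longleftrightarrow> infinite S \<or> k \<le> card S"

definition covering :: "('a \<rightharpoonup> point) \<Rightarrow> real \<Rightarrow> real \<Rightarrow> 'a set" where
  "covering x t m = {i. \<exists>b d. x i = Some (b, d) \<and> b \<le> t - m \<and> t + m \<le> d}"

lemma at_least_covering_cong:
  assumes "same_multiset x y"
  shows "at_least k (covering x t m) = at_least k (covering y t m)"
proof -
  obtain f where f: "bij_betw f (dom x) (dom y)" "\<forall>i \<in> dom x. y (f i) = x i"
    using assms unfolding same_multiset_def by blast
  have sub: "covering x t m \<subseteq> dom x"
    by (auto simp: covering_def)
  have "f ` covering x t m = covering y t m"
  proof
    show "f ` covering x t m \<subseteq> covering y t m"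
      using f(2) by (auto simp: covering_def dom_def)
    show "covering y t m \<subseteq> f ` covering x t m"
    proof
      fix j assume j: "j \<in> covering y t m"
      then have "j \<in> dom y" by (auto simp: covering_def)
      then obtain i where i: "i \<in> dom x" "j = f i"
        using f(1) unfolding bij_betw_def by blast
      with j f(2) have "i \<in> covering x t m" by (auto simp: covering_def)
      with i show "j \<in> f ` covering x t m" by blast
    qed
  qed
  then have "bij_betw f (covering x t m) (covering y t m)"
    using f(1) sub unfolding bij_betw_def by (auto intro: inj_on_subset)
  then show ?thesis
    by (simp add: at_least_def bij_betw_finite bij_betw_same_card)
qed

text \<open>
  The supremum is taken in \<^typ>\<open>ennreal\<close>, where \<open>Sup {} = 0\<close>. The family \<^term>\<open>off_diagonal x\<close> is the
  representative without diagonal points. Only the values at \<open>k \<ge> 1\<close> are meaningful.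
\<close>

lift_definition landscape :: "'a :: infinite persistence_diagram \<Rightarrow> nat \<Rightarrow> real \<Rightarrow> ennreal" is
  "\<lambda>x k t. SUP m \<in> {m. 0 \<le> m \<and> at_least k (covering (off_diagonal x) t m)}. ennreal m"
proof -
  fix x y :: "'a \<rightharpoonup> point"
  assume "diagram_equiv x y"
  then have "same_multiset (off_diagonal x) (off_diagonal y)"
    by (simp add: diagram_equiv_iff_off_diagonal)
  from at_least_covering_cong[OF this]
  show "(\<lambda>k t. SUP m \<in> {m. 0 \<le> m \<and> at_least k (covering (off_diagonal x) t m)}. ennreal m) =
        (\<lambda>k t. SUP m \<in> {m. 0 \<le> m \<and> at_least k (covering (off_diagonal y) t m)}. ennreal m)"
    by simp
qed

text \<open>
  The library sets \<open>\<infinity> - \<infinity> = \<infinity>\<close>, both in \<^typ>\<open>ereal\<close> and in \<^typ>\<open>ennreal\<close>; here it has to be \<open>0\<close>.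
\<close>

definition ext_diff :: "ennreal \<Rightarrow> ennreal \<Rightarrow> ereal" where
  "ext_diff a b = (if a = \<infinity> \<and> b = \<infinity> then 0 else enn2ereal a - enn2ereal b)"

definition Linf_norm :: "'a measure \<Rightarrow> ('a \<Rightarrow> ereal) \<Rightarrow> ennreal" where
  "Linf_norm M f = esssup M (\<lambda>x. e2ennreal \<bar>f x\<bar>)"

definition landscape_distance ::
    "'a :: infinite persistence_diagram \<Rightarrow> 'a persistence_diagram \<Rightarrow> ennreal" where
  "landscape_distance D D' =
     Linf_norm (count_space {1..} \<Otimes>\<^sub>M lebesgue)
       (\<lambda>(k, t). ext_diff (landscape D k t) (landscape D' k t))"

section \<open>Bottleneck distance\<close>

definition linf_dist :: "point \<Rightarrow> point \<Rightarrow> real" where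
  "linf_dist p q = max \<bar>fst p - fst q\<bar> \<bar>snd p - snd q\<bar>"

text \<open>
  Diagonal points are adjoined by the choice of the representatives \<open>x\<close> and \<open>y\<close>. The supremum over an
  empty family is \<open>0\<close>.
\<close>

definition bottleneck_distance ::
    "'a :: infinite persistence_diagram \<Rightarrow> 'a persistence_diagram \<Rightarrow> ennreal" where
  "bottleneck_distance D D' =
     (INF (x, y, \<phi>) \<in> {(x, y, \<phi>). represents x D \<and> represents y D' \<and> bij_betw \<phi> (dom x) (dom y)}.
        SUP i \<in> dom x. ennreal (linf_dist (the (x i)) (the (y (\<phi> i)))))"

end

theory Submission
  imports Defs
begin

text \<open>
  If \<open>k\<close> points of \<open>D\<close> cover the interval \<open>[t - m, t + m]\<close> and each of them is moved by at most \<open>e\<close>,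
  then their images cover \<open>[s - (m - e - \<bar>s - t\<bar>), s + (m - e - \<bar>s - t\<bar>)]\<close>, and they stay off the
  diagonal as long as this interval is nondegenerate. This one estimate, \<open>landscape_shift\<close>, has two
  uses. With \<open>s = t\<close> it bounds the difference of the landscapes pointwise. With \<open>e = 0\<close> it shows that
  each \<open>landscape D k\<close> is 1-Lipschitz or constantly \<open>\<infinity>\<close>, which gives the measurability without which
  \<^const>\<open>esssup\<close> is \<open>\<infinity>\<close> by convention.
\<close>

lemma at_least_inj_on:
  assumes "inj_on f S" "f ` S \<subseteq> T" "at_least k S"
  shows "at_least k T"
proof (cases "finite T")
  case True
  then have "finite S" "card S \<le> card T"
    using assms inj_on_finite card_inj_on_le by blast+
  then show ?thesis
    using assms(3) by (simp add: at_least_def)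
qed (simp add: at_least_def)

text \<open>The quotient is partial, so computing on a family needs it to be related to itself,
  which comes down to \<open>points_ok x\<close>.\<close>

lemma landscape_abs:
  assumes "points_ok x"
  shows "landscape (abs_persistence_diagram x) k t =
    (SUP m \<in> {m. 0 \<le> m \<and> at_least k (covering (off_diagonal x) t m)}. ennreal m)"
  by (subst landscape.abs_eq)
    (use assms in \<open>simp_all add: eq_onp_def diagram_equiv_iff_off_diagonal same_multiset_refl\<close>)

lemma covering_shift:
  assumes into: "\<phi> ` dom x \<subseteq> dom y"
    and dist: "\<And>i. i \<in> dom x \<Longrightarrow> linf_dist (the (x i)) (the (y (\<phi> i))) \<le> e"
    and pos: "m - (e + \<bar>s - t\<bar>) > 0"
  shows "\<phi> ` covering (off_diagonal x) t m \<subseteq> covering (off_diagonal y) s (m - (e + \<bar>s - t\<bar>))"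
proof (rule image_subsetI)
  fix i assume i: "i \<in> covering (off_diagonal x) t m"
  then have "i \<in> dom (off_diagonal x)"
    by (auto simp: covering_def)
  then obtain b d where x: "x i = Some (b, d)" "b \<le> t - m" "t + m \<le> d"
    using i off_diagonal_eq[of i x] by (auto simp: covering_def)
  then obtain b' d' where y: "y (\<phi> i) = Some (b', d')"
    using into by (metis domD domI image_subset_iff surj_pair)
  have "\<bar>b - b'\<bar> \<le> e" "\<bar>d - d'\<bar> \<le> e"
    using dist[of i] x(1) y by (auto simp: linf_dist_def)
  \<comment> \<open>Endpoints move by at most e and the center by \<open>\<bar>s - t\<bar>\<close>:
    b' \<le> b + e \<le> t - m + e, and symmetrically for d'.\<close>
  then have "b' \<le> s - (m - (e + \<bar>s - t\<bar>))" "s + (m - (e + \<bar>s - t\<bar>)) \<le> d'"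
    using x by linarith+
  moreover from this have "b' \<noteq> d'"
    using pos by linarith
  ultimately show "\<phi> i \<in> covering (off_diagonal y) s (m - (e + \<bar>s - t\<bar>))"
    using y off_diagonal_eq[of "\<phi> i" y] by (simp add: covering_def dom_off_diagonal)
qed

text \<open>An injection gives an inequality in one direction, so the lemma serves for a matching,
  for its inverse and for the identity.\<close>

lemma landscape_shift:
  assumes x: "represents x D" and y: "represents y D'"
    and \<phi>: "inj_on \<phi> (dom x)" "\<phi> ` dom x \<subseteq> dom y"
    and dist: "\<And>i. i \<in> dom x \<Longrightarrow> linf_dist (the (x i)) (the (y (\<phi> i))) \<le> e"
    and e: "0 \<le> e"
  shows "landscape D k t \<le> landscape D' k s + ennreal (e + \<bar>s - t\<bar>)"
proof -
  let ?c = "e + \<bar>s - t\<bar>"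
  have D: "landscape D k t =
      (SUP m \<in> {m. 0 \<le> m \<and> at_least k (covering (off_diagonal x) t m)}. ennreal m)"
    and D': "landscape D' k s =
      (SUP m \<in> {m. 0 \<le> m \<and> at_least k (covering (off_diagonal y) s m)}. ennreal m)"
    using x y landscape_abs by (auto simp: represents_def)
  have "ennreal m \<le> landscape D' k s + ennreal ?c"
    if "0 \<le> m" "at_least k (covering (off_diagonal x) t m)" for m
  \<comment> \<open>A radius of at most \<open>?c\<close> is absorbed by the error term. A larger
    one stays positive after shrinking by \<open>?c\<close>, as \<open>covering_shift\<close>
    requires.\<close>
  proof (cases "m \<le> ?c")
    case True
    then show ?thesis
      by (simp add: add_increasing ennreal_leI)
  next
    case False
    have "covering (off_diagonal x) t m \<subseteq> dom x"
      using dom_off_diagonal_subset[of x] by (force simp: covering_def)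
    then have "at_least k (covering (off_diagonal y) s (m - ?c))"
      using at_least_inj_on[OF _ covering_shift[OF \<phi>(2) dist] that(2)] \<phi>(1) False
      by (meson inj_on_subset diff_gt_0_iff_gt not_le)
    then have "ennreal (m - ?c) \<le> landscape D' k s"
      unfolding D' using False by (intro SUP_upper) auto
    then have "ennreal (m - ?c) + ennreal ?c \<le> landscape D' k s + ennreal ?c"
      by (rule add_right_mono)
    moreover have "ennreal (m - ?c) + ennreal ?c = ennreal m"
      using False e by (subst ennreal_plus[symmetric]) auto
    ultimately show ?thesis
      by simp
  qed
  then show ?thesis
    unfolding D by (intro SUP_least) auto
qed

lemma represents_exists: "\<exists>x. represents x D"
proof (induct D rule: persistence_diagram.abs_induct)
  case (1 x)
  then show ?case
    by (auto simp: represents_def diagram_equiv_iff_off_diagonal)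
qed

lemma landscape_Lipschitz: "landscape D k t \<le> landscape D k s + ennreal \<bar>s - t\<bar>"
proof -
  obtain x where "represents x D"
    using represents_exists by blast
  from landscape_shift[OF this this, of id 0] show ?thesis
    by (simp add: linf_dist_def)
qed

lemma borel_measurable_landscape: "landscape D k \<in> borel_measurable borel"
\<comment> \<open>One infinite value forces all values to be infinite; otherwise the landscape is a
  continuous real function.\<close>
proof (cases "\<exists>s. landscape D k s = \<infinity>")
  case True
  then obtain s where "landscape D k s = \<infinity>" ..
  then have "landscape D k t = \<infinity>" for t
    using landscape_Lipschitz[of D k s t] by (auto simp: top_unique)
  then have "landscape D k = (\<lambda>t. \<infinity>)"
    by blast
  then show ?thesis
    by simp
next
  case False
  then have fin: "landscape D k t = ennreal (enn2real (landscape D k t))" for t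
    by (simp add: less_top)
  have "enn2real (landscape D k t) \<le> enn2real (landscape D k s) + \<bar>s - t\<bar>" for s t
  proof -
    have "ennreal (enn2real (landscape D k t)) \<le> ennreal (enn2real (landscape D k s)) + ennreal \<bar>s - t\<bar>"
      using landscape_Lipschitz[of D k t s] fin by metis
    then show ?thesis
      by (simp flip: ennreal_plus)
  qed
  then have "\<bar>enn2real (landscape D k t) - enn2real (landscape D k s)\<bar> \<le> \<bar>t - s\<bar>" for s t
    by (smt (verit))
  then have "1-lipschitz_on UNIV (\<lambda>t. enn2real (landscape D k t))"
    by (intro lipschitz_onI) (simp_all add: dist_real_def)
  then have "(\<lambda>t. enn2real (landscape D k t)) \<in> borel_measurable borel"
    by (intro borel_measurable_continuous_onI lipschitz_on_continuous_on)
  then have "(\<lambda>t. ennreal (enn2real (landscape D k t))) \<in> borel_measurable borel"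
    by measurable
  then show ?thesis
    by (simp flip: fin)
qed

lemma borel_measurable_ext_diff:
  assumes [measurable]: "f \<in> borel_measurable M" "g \<in> borel_measurable M"
  shows "(\<lambda>x. ext_diff (f x) (g x)) \<in> borel_measurable M"
  unfolding ext_diff_def by measurable

text \<open>Closeness is expressed by sums, which make sense at \<infinity>. For finite c the two
  bounds make a and b both finite or both infinite.\<close>

lemma abs_ext_diff_le:
  assumes "a \<le> b + c" "b \<le> a + c"
  shows "e2ennreal \<bar>ext_diff a b\<bar> \<le> c"
proof (cases "c = \<infinity>")
  case False
  then obtain r where r: "c = ennreal r" "0 \<le> r"
    by (cases c) auto
  show ?thesis
  proof (cases a)
    case a: (real a')
    then have "b \<noteq> \<infinity>"
      using assms r by (auto simp: top_unique simp flip: ennreal_plus)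
    then obtain b' where b: "b = ennreal b'" "0 \<le> b'"
      by (cases b) auto
    have "\<bar>a' - b'\<bar> \<le> r"
      using assms a b r by (auto simp flip: ennreal_plus)
    then show ?thesis
      using a b r by (simp add: ext_diff_def e2ennreal_ereal ennreal_leI)
  next
    \<comment> \<open>Here a = b = \<infinity>, and the value 0 that \<open>ext_diff\<close> assigns
      to \<infinity> - \<infinity> gives the bound.\<close>
    case top
    then have "b = \<infinity>"
      using assms r by (cases b) (auto simp: top_unique simp flip: ennreal_plus)
    then show ?thesis
      using top by (simp add: ext_diff_def e2ennreal_neg)
  qed
qed simp

lemma landscape_distance_le:
  assumes "\<And>k t. landscape D k t \<le> landscape D' k t + c"
    and "\<And>k t. landscape D' k t \<le> landscape D k t + c"
  shows "landscape_distance D D' \<le> c"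
proof -
  let ?f = "\<lambda>(k, t). ext_diff (landscape D k t) (landscape D' k t)"
  \<comment> \<open>The index set is countable and discrete, so joint measurability reduces to that
    of each slice in t.\<close>
  have "?f \<in> borel_measurable (count_space {1..} \<Otimes>\<^sub>M lebesgue)"
  proof (rule measurable_pair_measure_countable1)
    fix k :: nat
    show "(\<lambda>t. ?f (k, t)) \<in> borel_measurable lebesgue"
      unfolding prod.case
      by (intro measurable_completion)
        (simp add: borel_measurable_ext_diff borel_measurable_landscape)
  qed simp
  then have "(\<lambda>p. e2ennreal \<bar>?f p\<bar>) \<in> borel_measurable (count_space {1..} \<Otimes>\<^sub>M lebesgue)"
    by measurable
  moreover have "e2ennreal \<bar>?f p\<bar> \<le> c" for p
    using assms by (auto simp: abs_ext_diff_le split: prod.split)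
  ultimately show ?thesis
    unfolding landscape_distance_def Linf_norm_def by (intro esssup_I) auto
qed

theorem theorem5p2:
  fixes D D' :: "'a :: infinite persistence_diagram"
  shows "landscape_distance D D' \<le> bottleneck_distance D D'"
proof -
  have "landscape_distance D D' \<le> (SUP i \<in> dom x. ennreal (linf_dist (the (x i)) (the (y (\<phi> i)))))"
    (is "_ \<le> ?c")
    if x: "represents x D" and y: "represents y D'" and \<phi>: "bij_betw \<phi> (dom x) (dom y)"
    for x y :: "'a \<rightharpoonup> point" and \<phi>
  proof (cases ?c)
    \<comment> \<open>A finite supremum is a real e bounding every displacement; an infinite one
      bounds the distance trivially.\<close>
    case (real e)
    have le: "linf_dist (the (x i)) (the (y (\<phi> i))) \<le> e" if "i \<in> dom x" for i
    proof -
      have "ennreal (linf_dist (the (x i)) (the (y (\<phi> i)))) \<le> ennreal e"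
        unfolding real(2)[symmetric] using that by (rule SUP_upper)
      then show ?thesis
        using real(1) by simp
    qed
    \<comment> \<open>The inverse matching has the same displacements, so the estimate also applies
      with D and D' exchanged.\<close>
    let ?\<psi> = "inv_into (dom x) \<phi>"
    have \<psi>: "bij_betw ?\<psi> (dom y) (dom x)"
      using \<phi> by (rule bij_betw_inv_into)
    have le': "linf_dist (the (y j)) (the (x (?\<psi> j))) \<le> e" if "j \<in> dom y" for j
    proof -
      have "?\<psi> j \<in> dom x" "\<phi> (?\<psi> j) = j"
        using that \<psi> \<phi> bij_betwE bij_betw_inv_into_right by metis+
      then show ?thesis
        using le[of "?\<psi> j"] by (simp add: linf_dist_def abs_minus_commute)
    qed
    have "landscape D k t \<le> landscape D' k t + ennreal e" for k t
      using landscape_shift[OF x y, of \<phi> e k t t] \<phi> le real(1) by (simp add: bij_betw_def)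
    moreover have "landscape D' k t \<le> landscape D k t + ennreal e" for k t
      using landscape_shift[OF y x, of ?\<psi> e k t t] \<psi> le' real(1) by (simp add: bij_betw_def)
    ultimately show ?thesis
      unfolding real(2) by (rule landscape_distance_le)
  next
    case top
    then show ?thesis
      by (simp only: top_greatest)
  qed
  then show ?thesis
    unfolding bottleneck_distance_def by (intro INF_greatest) auto
qed

end
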